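(* \textsc{$c$-Closed Vertex Deletion} can be solved in $\mathcal{O}(n)$ time on graphs with maximum degree $\Delta=2$ when $c=2$, and on graphs with maximum degree $\Delta=3$ when $c=3$, where $n$ is the number of vertices.
   Context: A graph is $c$-closed if every pair of distinct nonadjacent vertices has at most $c-1$ common neighbors. \textsc{$c$-Closed Vertex Deletion}: given a graph $G=(V,E)$ and a positive integer $k$, decide whether there is $S\subseteq V$ with $|S|\le k$ such that $G-S$ (the subgraph induced by $V\setminus S$) is $c$-closed. *)

theory Defs
  imports "Graph_Theory.Graph_Theory" "HOL-Library.Landau_Symbols"
begin

section \<open>$c$-closed graphs and vertex deletion\<close>

text \<open>
  A finite simple undirected graph is a loop-free symmetric digraph without parallel arcs
  (\<open>graph\<close>, respectively \<open>pair_graph\<close> when arcs are pairs of vertices); adjacency is \<open>dominates\<close>,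
  and the degree of a vertex is its out-degree.
\<close>

definition common_neighbors :: "('a, 'b) pre_digraph \<Rightarrow> 'a \<Rightarrow> 'a \<Rightarrow> 'a set" where
  "common_neighbors G u v = {w \<in> verts G. u \<rightarrow>\<^bsub>G\<^esub> w \<and> v \<rightarrow>\<^bsub>G\<^esub> w}"

definition c_closed :: "nat \<Rightarrow> ('a, 'b) pre_digraph \<Rightarrow> bool" where
  "c_closed c G \<longleftrightarrow>
    (\<forall>u \<in> verts G. \<forall>v \<in> verts G. u \<noteq> v \<and> \<not> u \<rightarrow>\<^bsub>G\<^esub> v \<longrightarrow> card (common_neighbors G u v) \<le> c - 1)"

definition c_closed_vertex_deletion :: "nat \<Rightarrow> ('a, 'b) pre_digraph \<Rightarrow> nat \<Rightarrow> bool" where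
  "c_closed_vertex_deletion c G k \<longleftrightarrow>
    (\<exists>S \<subseteq> verts G. card S \<le> k \<and> c_closed c (G \<restriction> (verts G - S)))"

definition max_degree :: "('a, 'b) pre_digraph \<Rightarrow> nat" where
  "max_degree G = Max (insert 0 (out_degree G ` verts G))"

section \<open>Random access machines with uniform cost\<close>

text \<open>
  The random access machine of Cook and Reckhow over natural numbers: memory cells
  \<open>X\<^sub>0, X\<^sub>1, \<dots>\<close>, initially all zero, and a read-once input tape. Every instruction takes one time
  step. The machine halts when the program counter leaves the program.
\<close>

datatype instr =
    Read nat           \<comment> \<open>\<open>X\<^sub>i := \<close> next number on the input tape (\<open>0\<close> at its end)\<close>
  | Const nat nat      \<comment> \<open>\<open>X\<^sub>i := c\<close>\<close>
  | Add nat nat nat    \<comment> \<open>\<open>X\<^sub>i := X\<^sub>j + X\<^sub>l\<close>\<close>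
  | Sub nat nat nat    \<comment> \<open>\<open>X\<^sub>i := X\<^sub>j - X\<^sub>l\<close>, truncated at \<open>0\<close>\<close>
  | Load nat nat       \<comment> \<open>\<open>X\<^sub>i := X\<^bsub>X\<^sub>j\<^esub>\<close>\<close>
  | Store nat nat      \<comment> \<open>\<open>X\<^bsub>X\<^sub>i\<^esub> := X\<^sub>j\<close>\<close>
  | JPos nat nat       \<comment> \<open>if \<open>X\<^sub>i > 0\<close>, continue with instruction number \<open>m\<close>\<close>

record config =
  pc :: nat
  mem :: "nat \<Rightarrow> nat"
  tape :: "nat list"

fun exec :: "instr \<Rightarrow> config \<Rightarrow> config" where
  "exec (Read i) s =
    s\<lparr>pc := pc s + 1, mem := (mem s)(i := (case tape s of [] \<Rightarrow> 0 | x # _ \<Rightarrow> x)), tape := tl (tape s)\<rparr>"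
| "exec (Const i c) s = s\<lparr>pc := pc s + 1, mem := (mem s)(i := c)\<rparr>"
| "exec (Add i j l) s = s\<lparr>pc := pc s + 1, mem := (mem s)(i := mem s j + mem s l)\<rparr>"
| "exec (Sub i j l) s = s\<lparr>pc := pc s + 1, mem := (mem s)(i := mem s j - mem s l)\<rparr>"
| "exec (Load i j) s = s\<lparr>pc := pc s + 1, mem := (mem s)(i := mem s (mem s j))\<rparr>"
| "exec (Store i j) s = s\<lparr>pc := pc s + 1, mem := (mem s)(mem s i := mem s j)\<rparr>"
| "exec (JPos i m) s = s\<lparr>pc := (if mem s i > 0 then m else pc s + 1)\<rparr>"

definition halted :: "instr list \<Rightarrow> config \<Rightarrow> bool" where
  "halted P s \<longleftrightarrow> length P \<le> pc s"

definition ram_step :: "instr list \<Rightarrow> config \<Rightarrow> config" where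
  "ram_step P s = (if halted P s then s else exec (P ! pc s) s)"

definition initial :: "nat list \<Rightarrow> config" where
  "initial xs = \<lparr>pc = 0, mem = (\<lambda>_. 0), tape = xs\<rparr>"

text \<open>
  Halted configurations are fixed points of \<open>ram_step\<close>, so being halted after \<open>t\<close> iterations
  means halting within \<open>t\<close> steps. The answer (\<open>1\<close> for yes, \<open>0\<close> for no) is left in \<open>X\<^sub>0\<close>.
\<close>

definition answers_within :: "instr list \<Rightarrow> nat list \<Rightarrow> nat \<Rightarrow> bool \<Rightarrow> bool" where
  "answers_within P xs t b \<longleftrightarrow>
    (let s = (ram_step P ^^ t) (initial xs) in halted P s \<and> mem s 0 = (if b then 1 else 0))"

section \<open>Instances as machine inputs\<close>

text \<open>
  As usual for graph algorithms, the vertices of an input graph are \<open>0, \<dots>, n - 1\<close>, and the graph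
  is given by adjacency lists, in which the neighbors of a vertex are listed in any order.
\<close>

definition adjacency_lists :: "nat pair_pre_digraph \<Rightarrow> nat list list \<Rightarrow> bool" where
  "adjacency_lists G adj \<longleftrightarrow>
    pverts G = {..<length adj} \<and>
    (\<forall>v < length adj. distinct (adj ! v) \<and> set (adj ! v) = {w. v \<rightarrow>\<^bsub>G\<^esub> w})"

text \<open>The tape holds \<open>n\<close> and \<open>k\<close>, followed by every adjacency list preceded by its length.\<close>

definition encode :: "nat list list \<Rightarrow> nat \<Rightarrow> nat list" where
  "encode adj k = length adj # k # concat (map (\<lambda>ns. length ns # ns) adj)"

definition solves_c_closed_vertex_deletion ::
  "instr list \<Rightarrow> nat \<Rightarrow> nat pair_pre_digraph set \<Rightarrow> (nat \<Rightarrow> nat) \<Rightarrow> bool" where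
  "solves_c_closed_vertex_deletion P c \<G> T \<longleftrightarrow>
    (\<forall>G \<in> \<G>. \<forall>adj k. pair_graph G \<and> adjacency_lists G adj \<and> 0 < k \<longrightarrow>
      answers_within P (encode adj k) (T (card (pverts G))) (c_closed_vertex_deletion c G k))"

end

theory Submission
  imports Defs "HOL-Library.More_List"
begin

text \<open>
  If all degrees are at most \<open>c\<close>, then a pair violating \<open>c\<close>-closedness consists of twins: vertices
  \<open>x, y\<close> with the same neighborhood, of size \<open>c\<close>. Deleting vertices creates no new such pair, so a
  solution is a set that meets \<open>{x, y} \<union> N x\<close> for all twins \<open>x, y\<close>. For \<open>c \<le> 3\<close> the greedy
  algorithm that goes through the vertices and deletes \<open>x\<close> whenever some \<open>{x, y} \<union> N x\<close> is not yet
  met is optimal, since some vertex of any other solution can be exchanged for \<open>x\<close>. The twins of \<open>x\<close>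
  are neighbors of the first neighbor of \<open>x\<close>, so each vertex takes constant time.

  On the machine this test is a single arithmetic expression that vanishes iff \<open>x\<close> has to be
  deleted, so the program consists of three loops with branch-free bodies.
\<close>

section \<open>A loop language for the machine\<close>

datatype expr = Lit nat | Var nat | Plus expr expr | Minus expr expr | Heap expr

datatype stmt = Assign nat expr | Write expr expr | Input nat

text \<open>\<open>Loop x b\<close> is a do-while loop, repeated as long as variable
  \<open>x\<close> is positive. Bodies are straight-line code, so all rounds of a loop cost the same
  number of machine steps.\<close>

datatype com = Block "stmt list" | Loop nat "stmt list"

type_synonym state = "(nat \<Rightarrow> nat) \<times> (nat \<Rightarrow> nat) \<times> nat list"

fun eval :: "expr \<Rightarrow> (nat \<Rightarrow> nat) \<Rightarrow> (nat \<Rightarrow> nat) \<Rightarrow> nat" where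
  "eval (Lit k) v h = k"
| "eval (Var x) v h = v x"
| "eval (Plus a b) v h = eval a v h + eval b v h"
| "eval (Minus a b) v h = eval a v h - eval b v h"
| "eval (Heap a) v h = h (eval a v h)"

fun run_stmt :: "stmt \<Rightarrow> state \<Rightarrow> state" where
  "run_stmt (Assign x a) (v, h, xs) = (v(x := eval a v h), h, xs)"
| "run_stmt (Write a b) (v, h, xs) = (v, h(eval a v h := eval b v h), xs)"
| "run_stmt (Input x) (v, h, xs) = (v(x := (case xs of [] \<Rightarrow> 0 | y # _ \<Rightarrow> y)), h, tl xs)"

abbreviation run :: "stmt list \<Rightarrow> state \<Rightarrow> state" where
  "run \<equiv> fold run_stmt"

definition num_vars :: nat where "num_vars = 9"

definition heap_base :: nat where "heap_base = 64"

text \<open>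
  The cells below \<open>num_vars\<close> hold the variables, those from \<open>heap_base\<close> on the heap, and the
  cells in between are scratch space for the evaluation of expressions. As every address is
  relative to \<open>heap_base\<close>, even a meaningless heap access never sees a scratch cell, and so
  expressions have a well-defined value whatever the heap contains.
\<close>

fun compile_expr :: "nat \<Rightarrow> expr \<Rightarrow> instr list" where
  "compile_expr r (Lit k) = [Const r k]"
| "compile_expr r (Var x) = [Const r 0, Add r r x]"
| "compile_expr r (Plus a b) = compile_expr r a @ compile_expr (Suc r) b @ [Add r r (Suc r)]"
| "compile_expr r (Minus a b) = compile_expr r a @ compile_expr (Suc r) b @ [Sub r r (Suc r)]"
| "compile_expr r (Heap a) =
    compile_expr r a @ [Const (Suc r) heap_base, Add r r (Suc r), Load r r]"

fun fits :: "nat \<Rightarrow> expr \<Rightarrow> bool" where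
  "fits r (Lit k) \<longleftrightarrow> r < heap_base"
| "fits r (Var x) \<longleftrightarrow> r < heap_base \<and> x < num_vars"
| "fits r (Plus a b) \<longleftrightarrow> fits r a \<and> fits (Suc r) b"
| "fits r (Minus a b) \<longleftrightarrow> fits r a \<and> fits (Suc r) b"
| "fits r (Heap a) \<longleftrightarrow> fits r a \<and> Suc r < heap_base"

fun compile_stmt :: "stmt \<Rightarrow> instr list" where
  "compile_stmt (Assign x a) =
    compile_expr num_vars a @ [Const (Suc num_vars) 0, Add x num_vars (Suc num_vars)]"
| "compile_stmt (Write a b) =
    compile_expr num_vars a @ compile_expr (Suc num_vars) b @
    [Const (Suc (Suc num_vars)) heap_base, Add num_vars num_vars (Suc (Suc num_vars)),
     Store num_vars (Suc num_vars)]"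
| "compile_stmt (Input x) = [Read x]"

fun fits_stmt :: "stmt \<Rightarrow> bool" where
  "fits_stmt (Assign x a) \<longleftrightarrow> x < num_vars \<and> fits num_vars a"
| "fits_stmt (Write a b) \<longleftrightarrow> fits num_vars a \<and> fits (Suc num_vars) b"
| "fits_stmt (Input x) \<longleftrightarrow> x < num_vars"

definition compile_block :: "stmt list \<Rightarrow> instr list" where
  "compile_block b = concat (map compile_stmt b)"

text \<open>\<open>l\<close> is the address of the first emitted instruction; it is carried along
  because jump targets are absolute.\<close>

fun compile :: "nat \<Rightarrow> com list \<Rightarrow> instr list" where
  "compile l [] = []"
| "compile l (Block b # cs) = compile_block b @ compile (l + length (compile_block b)) cs"
| "compile l (Loop x b # cs) =
    compile_block b @ [JPos x l] @ compile (l + length (compile_block b) + 1) cs"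

fun fits_com :: "com \<Rightarrow> bool" where
  "fits_com (Block b) \<longleftrightarrow> list_all fits_stmt b"
| "fits_com (Loop x b) \<longleftrightarrow> x < num_vars \<and> list_all fits_stmt b"

text \<open>The time counts machine steps exactly, with one extra step per round for the jump. The
  loop variable must run through \<open>m - 1, ..., 0\<close>, so it is positive after every round
  but the last.\<close>

inductive runs :: "com list \<Rightarrow> state \<Rightarrow> nat \<Rightarrow> state \<Rightarrow> bool" where
  runs_Nil: "runs [] s 0 s"
| runs_Block: "runs cs (run b s) t s' \<Longrightarrow> runs (Block b # cs) s (length (compile_block b) + t) s'"
| runs_Loop: "0 < m \<Longrightarrow> (\<And>i. i < m \<Longrightarrow> fst ((run b ^^ Suc i) s) x = m - Suc i) \<Longrightarrow>
    runs cs ((run b ^^ m) s) t s' \<Longrightarrow>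
    runs (Loop x b # cs) s (m * (length (compile_block b) + 1) + t) s'"

section \<open>Simulation of the loop language by the machine\<close>

fun represents :: "config \<Rightarrow> state \<Rightarrow> bool" where
  "represents s (v, h, xs) \<longleftrightarrow>
    (\<forall>x < num_vars. mem s x = v x) \<and> (\<forall>i. mem s (heap_base + i) = h i) \<and> tape s = xs"

lemma represents_pc [simp]: "represents (s\<lparr>pc := l\<rparr>) st = represents s st"
  by (cases st) auto

fun is_jump :: "instr \<Rightarrow> bool" where
  "is_jump (JPos _ _) = True"
| "is_jump _ = False"

lemma pc_exec: "\<not> is_jump i \<Longrightarrow> pc (exec i s) = Suc (pc s)"
  by (cases i) auto

lemma fits_less: "fits r a \<Longrightarrow> r < heap_base"
  by (induction a arbitrary: r) auto

text \<open>The cells from \<open>r\<close> on serve as a stack. That cells below \<open>r\<close>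
  survive keeps the left operand in \<open>r\<close> intact while the right one is computed in
  \<open>Suc r\<close>.\<close>

lemma fold_exec_compile_expr:
  assumes "represents s (v, h, xs)" "fits r a" "num_vars \<le> r" "s' = fold exec (compile_expr r a) s"
  shows "represents s' (v, h, xs) \<and> mem s' r = eval a v h \<and> (\<forall>x < r. mem s' x = mem s x)"
  using assms
proof (induction a arbitrary: r s s')
  case (Plus a b)
  define s1 where "s1 = fold exec (compile_expr r a) s"
  define s2 where "s2 = fold exec (compile_expr (Suc r) b) s1"
  have 1: "represents s1 (v, h, xs)" "mem s1 r = eval a v h" "\<forall>x < r. mem s1 x = mem s x"
    using Plus.IH(1)[OF Plus.prems(1) _ Plus.prems(3) s1_def] Plus.prems(2) by auto
  have 2: "represents s2 (v, h, xs)" "mem s2 (Suc r) = eval b v h" "\<forall>x < Suc r. mem s2 x = mem s1 x"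
    using Plus.IH(2)[OF 1(1) _ _ s2_def] Plus.prems(2,3) by auto
  have "s' = exec (Add r r (Suc r)) s2"
    using Plus.prems(4) by (simp add: s1_def s2_def)
  then show ?case
    using 1 2 Plus.prems(2,3) fits_less[of r a] by auto
next
  case (Minus a b)
  define s1 where "s1 = fold exec (compile_expr r a) s"
  define s2 where "s2 = fold exec (compile_expr (Suc r) b) s1"
  have 1: "represents s1 (v, h, xs)" "mem s1 r = eval a v h" "\<forall>x < r. mem s1 x = mem s x"
    using Minus.IH(1)[OF Minus.prems(1) _ Minus.prems(3) s1_def] Minus.prems(2) by auto
  have 2: "represents s2 (v, h, xs)" "mem s2 (Suc r) = eval b v h" "\<forall>x < Suc r. mem s2 x = mem s1 x"
    using Minus.IH(2)[OF 1(1) _ _ s2_def] Minus.prems(2,3) by auto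
  have "s' = exec (Sub r r (Suc r)) s2"
    using Minus.prems(4) by (simp add: s1_def s2_def)
  then show ?case
    using 1 2 Minus.prems(2,3) fits_less[of r a] by auto
next
  case (Heap a)
  define s1 where "s1 = fold exec (compile_expr r a) s"
  have 1: "represents s1 (v, h, xs)" "mem s1 r = eval a v h" "\<forall>x < r. mem s1 x = mem s x"
    using Heap.IH[OF Heap.prems(1) _ Heap.prems(3) s1_def] Heap.prems(2) by auto
  have "s' = exec (Load r r) (exec (Add r r (Suc r)) (exec (Const (Suc r) heap_base) s1))"
    using Heap.prems(4) by (simp add: s1_def)
  then show ?case
    using 1 Heap.prems(2,3) by (auto simp: add.commute[of _ heap_base])
qed auto

lemma num_vars_less: "Suc (Suc num_vars) < heap_base"
  by (simp add: num_vars_def heap_base_def)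

lemma fold_exec_compile_stmt:
  assumes "represents s st" "fits_stmt c"
  shows "represents (fold exec (compile_stmt c) s) (run_stmt c st)"
proof -
  obtain v h xs where st: "st = (v, h, xs)" by (cases st)
  show ?thesis
  proof (cases c)
    case (Assign x a)
    define s1 where "s1 = fold exec (compile_expr num_vars a) s"
    have "represents s1 (v, h, xs)" "mem s1 num_vars = eval a v h"
      using fold_exec_compile_expr[OF _ _ _ s1_def] assms Assign st by auto
    then show ?thesis
      using Assign st assms(2) num_vars_less by (auto simp: s1_def[symmetric])
  next
    case (Write a b)
    define s1 where "s1 = fold exec (compile_expr num_vars a) s"
    define s2 where "s2 = fold exec (compile_expr (Suc num_vars) b) s1"
    have 1: "represents s1 (v, h, xs)" "mem s1 num_vars = eval a v h"
      using fold_exec_compile_expr[OF _ _ _ s1_def] assms Write st by auto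
    have 2: "represents s2 (v, h, xs)" "mem s2 (Suc num_vars) = eval b v h"
        "mem s2 num_vars = eval a v h"
      using fold_exec_compile_expr[OF 1(1) _ _ s2_def] assms(2) Write 1(2) by auto
    then show ?thesis
      using Write st num_vars_less
      by (auto simp: s1_def[symmetric] s2_def[symmetric] add.commute[of _ heap_base])
  next
    case (Input x)
    then show ?thesis
      using st assms num_vars_less by auto
  qed
qed

lemma fold_exec_compile_block:
  assumes "represents s st" "list_all fits_stmt b"
  shows "represents (fold exec (compile_block b) s) (run b st)"
  using assms
proof (induction b arbitrary: s st)
  case (Cons c b)
  then show ?case
    using fold_exec_compile_stmt[of s st c] by (simp add: compile_block_def)
qed (simp add: compile_block_def)

lemma compile_expr_no_jump: "i \<in> set (compile_expr r a) \<Longrightarrow> \<not> is_jump i"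
  by (induction a arbitrary: r) auto

lemma compile_block_no_jump: "i \<in> set (compile_block b) \<Longrightarrow> \<not> is_jump i"
proof (induction b)
  case (Cons c b)
  then show ?case
    by (cases c) (auto simp: compile_block_def compile_expr_no_jump)
qed (simp add: compile_block_def)

text \<open>The prefix \<open>P1\<close> is arbitrary because the induction moves each executed
  instruction from \<open>B\<close> into it.\<close>

lemma ram_steps_no_jump:
  assumes "\<And>i. i \<in> set B \<Longrightarrow> \<not> is_jump i" "pc s = length P1"
  shows "(ram_step (P1 @ B @ P2) ^^ length B) s = fold exec B s \<and>
    pc (fold exec B s) = length P1 + length B"
  using assms
proof (induction B arbitrary: P1 s)
  case (Cons i B)
  have "(ram_step ((P1 @ [i]) @ B @ P2) ^^ length B) (exec i s) = fold exec B (exec i s) \<and>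
      pc (fold exec B (exec i s)) = length (P1 @ [i]) + length B"
    using Cons.prems by (intro Cons.IH) (auto simp: pc_exec)
  moreover have "ram_step (P1 @ (i # B) @ P2) s = exec i s"
    using Cons.prems(2) by (simp add: ram_step_def halted_def nth_append)
  ultimately show ?case
    by (simp add: funpow_Suc_right del: funpow.simps)
qed simp

lemma ram_steps_compile_block:
  fixes P2 :: "instr list"
  assumes "pc s = length P1" "represents s st" "list_all fits_stmt b"
  defines "B \<equiv> compile_block b"
  defines "s' \<equiv> (ram_step (P1 @ B @ P2) ^^ length B) s"
  shows "pc s' = length P1 + length B" "represents s' (run b st)"
  using ram_steps_no_jump[of "compile_block b" s P1 P2, OF compile_block_no_jump assms(1)]
    fold_exec_compile_block[OF assms(2,3)]
  by (auto simp: s'_def B_def)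

lemma ram_steps_loop:
  fixes P2 :: "instr list"
  assumes "pc s = length P1" "represents s st" "list_all fits_stmt b" "x < num_vars" "0 < m"
    and "\<And>i. i < m \<Longrightarrow> fst ((run b ^^ Suc i) st) x = m - Suc i"
  defines "B \<equiv> compile_block b"
  defines "P \<equiv> P1 @ B @ [JPos x (length P1)] @ P2"
  defines "s' \<equiv> (ram_step P ^^ (m * (length B + 1))) s"
  shows "pc s' = length P1 + length B + 1 \<and> represents s' ((run b ^^ m) st)"
proof -
  \<comment> \<open>After \<open>j\<close> full rounds the machine is back at the head of the loop;
    after round \<open>m\<close> it has fallen through the jump.\<close>
  have "pc ((ram_step P ^^ (j * (length B + 1))) s) = (if j < m then length P1 else length P1 + length B + 1)
      \<and> represents ((ram_step P ^^ (j * (length B + 1))) s) ((run b ^^ j) st)" if "j \<le> m" for j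
    using that
  proof (induction j)
    case 0
    then show ?case using assms(1,2,5) by simp
  next
    case (Suc j)
    define s1 where "s1 = (ram_step P ^^ (j * (length B + 1))) s"
    define s2 where "s2 = (ram_step P ^^ length B) s1"
    have 1: "pc s1 = length P1" "represents s1 ((run b ^^ j) st)"
      using Suc by (auto simp: s1_def)
    have 2: "pc s2 = length P1 + length B" "represents s2 ((run b ^^ Suc j) st)"
      using ram_steps_compile_block[OF 1 assms(3), of "[JPos x (length P1)] @ P2"]
      by (auto simp: s2_def B_def P_def)
    have "mem s2 x = m - Suc j"
      using 2(2) assms(4) assms(6)[of j] Suc.prems by (cases "(run b ^^ Suc j) st") auto
    moreover have "(ram_step P ^^ (Suc j * (length B + 1))) s = ram_step P s2"
    proof -
      have "Suc j * (length B + 1) = Suc (length B + j * (length B + 1))"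
        by simp
      then show ?thesis
        by (simp only: funpow.simps funpow_add o_apply s1_def s2_def)
    qed
    moreover have "ram_step P s2 = exec (JPos x (length P1)) s2"
      using 2(1) by (simp add: ram_step_def halted_def P_def nth_append)
    ultimately show ?case
      using 2 Suc.prems by (simp del: funpow.simps)
  qed
  from this[of m] show ?thesis
    by (simp add: s'_def)
qed

text \<open>In the induction \<open>P1\<close> absorbs the code already executed, so
  \<open>length P1\<close> is always the address passed to \<open>compile\<close>.\<close>

lemma ram_steps_compile:
  assumes "runs cs st t st'" "list_all fits_com cs" "pc s = length P1" "represents s st"
    and "P = P1 @ compile (length P1) cs"
  shows "pc ((ram_step P ^^ t) s) = length P \<and> represents ((ram_step P ^^ t) s) st'"
  using assms
proof (induction arbitrary: P1 s)
  case (runs_Nil st)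
  then show ?case by simp
next
  case (runs_Block cs b st t st')
  define B where "B = compile_block b"
  have P: "P = P1 @ B @ compile (length P1 + length B) cs"
    using runs_Block.prems(4) by (simp add: B_def)
  define s1 where "s1 = (ram_step P ^^ length B) s"
  have "pc s1 = length (P1 @ B)" "represents s1 (run b st)"
    using ram_steps_compile_block[OF runs_Block.prems(2,3), of b] runs_Block.prems(1) P
    by (auto simp: s1_def B_def)
  then have "pc ((ram_step P ^^ t) s1) = length P \<and> represents ((ram_step P ^^ t) s1) st'"
    using runs_Block.prems(1) P by (intro runs_Block.IH[of s1 "P1 @ B"]) auto
  then show ?case
    by (simp add: s1_def B_def add.commute[of _ t] funpow_add)
next
  case (runs_Loop m b st x cs t st')
  define B where "B = compile_block b"
  have P: "P = P1 @ B @ [JPos x (length P1)] @ compile (length P1 + length B + 1) cs"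
    using runs_Loop.prems(4) by (simp add: B_def)
  define s1 where "s1 = (ram_step P ^^ (m * (length B + 1))) s"
  have "pc s1 = length (P1 @ B @ [JPos x (length P1)])" "represents s1 ((run b ^^ m) st)"
    using ram_steps_loop[OF runs_Loop.prems(2,3) _ _ runs_Loop.hyps(1,2)] runs_Loop.prems(1) P
    by (auto simp: s1_def B_def)
  then have "pc ((ram_step P ^^ t) s1) = length P \<and> represents ((ram_step P ^^ t) s1) st'"
    using runs_Loop.prems(1) P
    by (intro runs_Loop.IH[of s1 "P1 @ B @ [JPos x (length P1)]"]) auto
  then show ?case
    by (simp only: s1_def B_def add.commute[of _ t] funpow_add o_apply)
qed

lemma answers_within_compile:
  assumes "runs cs (\<lambda>_. 0, \<lambda>_. 0, xs) t (v, h, ys)" "list_all fits_com cs"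
    and "v 0 = (if b then 1 else 0)"
  shows "answers_within (compile 0 cs) xs t b"
proof -
  have "pc ((ram_step (compile 0 cs) ^^ t) (initial xs)) = length (compile 0 cs) \<and>
      represents ((ram_step (compile 0 cs) ^^ t) (initial xs)) (v, h, ys)"
    using assms(2) by (intro ram_steps_compile[OF assms(1), where ?P1.0 = "[]"]) (auto simp: initial_def)
  then show ?thesis
    using assms(3) by (auto simp: answers_within_def halted_def Let_def num_vars_def)
qed

section \<open>Optimality of the greedy algorithm\<close>

locale bounded_degree_graph =
  fixes V :: "'a set" and N :: "'a \<Rightarrow> 'a set" and c :: nat
  assumes finite_V: "finite V"
    and N_subset: "x \<in> V \<Longrightarrow> N x \<subseteq> V"
    and N_sym: "x \<in> V \<Longrightarrow> y \<in> N x \<Longrightarrow> x \<in> N y"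
    and N_irrefl: "x \<in> V \<Longrightarrow> x \<notin> N x"
    and card_N: "x \<in> V \<Longrightarrow> card (N x) \<le> c"
    and c_pos: "0 < c"
    and c_le: "c \<le> 3"
begin

definition twins :: "'a \<Rightarrow> 'a \<Rightarrow> bool" where
  "twins x y \<longleftrightarrow> x \<in> V \<and> y \<in> V \<and> x \<noteq> y \<and> N x = N y \<and> card (N x) = c"

definition hits :: "'a set \<Rightarrow> 'a \<Rightarrow> 'a \<Rightarrow> bool" where
  "hits S x y \<longleftrightarrow> S \<inter> ({x, y} \<union> N x) \<noteq> {}"

definition hitting_set :: "'a set \<Rightarrow> bool" where
  "hitting_set S \<longleftrightarrow> S \<subseteq> V \<and> (\<forall>x y. twins x y \<longrightarrow> hits S x y)"

lemma finite_N: "x \<in> V \<Longrightarrow> finite (N x)"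
  using N_subset finite_V by (rule finite_subset)

lemma hits_mono: "hits S x y \<Longrightarrow> S \<subseteq> S' \<Longrightarrow> hits S' x y"
  unfolding hits_def by blast

text \<open>The hypothesis on \<open>x\<close> describes a pair \<open>p, q\<close> that deleting
  \<open>x\<close> leaves unhit. If the shared vertex \<open>s\<close> is one of the twins, symmetry
  and equal neighborhoods settle the case. If it is adjacent to all four, they cannot be distinct,
  as \<open>N s\<close> has at most three elements.\<close>

lemma twins_sharing_neighbor:
  assumes "twins x y" "twins p q" "x \<notin> {p, q} \<union> N p"
    and "s \<in> {x, y} \<union> N x" "s \<in> {p, q} \<union> N p"
  shows "N p = N x \<and> y \<in> {p, q}"
proof -
  note t = assms(1,2)[unfolded twins_def]
  consider "s = x" | "s = y" "s \<in> {p, q}" | "s = y" "s \<in> N p" | "s \<in> N x" "s \<in> {p, q}"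
    | "s \<in> N x" "s \<in> N p"
    using assms(4,5) by blast
  then show ?thesis
  proof cases
    case 1
    then show ?thesis using assms(3,5) by blast
  next
    case 2
    then show ?thesis using t by auto
  next
    case 3
    then have "p \<in> N x" using N_sym[of p s] t by auto
    then show ?thesis using N_sym[of x p] t assms(3) by auto
  next
    case 4
    then have "x \<in> N s" using N_sym[of x s] t by auto
    then show ?thesis using 4 t assms(3) by auto
  next
    case 5
    have sV: "s \<in> V" using 5 t N_subset by blast
    have sub: "{x, y, p, q} \<subseteq> N s"
      using 5 t N_sym[of x s] N_sym[of y s] N_sym[of p s] N_sym[of q s] by auto
    have "y \<in> {p, q}"
    proof (rule ccontr)
      assume "y \<notin> {p, q}"
      then have "card {x, y, p, q} = 4"
        using t assms(3) by auto
      then show False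
        using card_mono[OF finite_N[OF sV] sub] card_N[OF sV] c_le by simp
    qed
    then show ?thesis using t by auto
  qed
qed

text \<open>
  A vertex of \<open>S\<close> hitting \<open>x, y\<close> can be exchanged for \<open>x\<close>. This could only fail for a
  third twin \<open>z\<close>, but then \<open>x, y, z\<close> and their neighbors form a component \<open>K\<^sub>3\<^sub>,\<^sub>3\<close>, in which \<open>S\<close> has at
  least two vertices.
\<close>

lemma exchange:
  assumes S: "hitting_set S" and xy: "twins x y" and "x \<notin> S"
  obtains s where "s \<in> S" "s \<in> {x, y} \<union> N x" "hitting_set (insert x (S - {s}))"
proof -
  note t = xy[unfolded twins_def]
  have hit: "hits S p q" if "twins p q" for p q
    using S that by (auto simp: hitting_set_def)
  obtain s where s: "s \<in> S" "s \<in> {x, y} \<union> N x"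
    using hit[OF xy] by (auto simp: hits_def)
  have "s \<noteq> x" using s assms(3) by auto
  \<comment> \<open>If a third twin \<open>z\<close> exists, the pair \<open>y, z\<close> is hit by
    \<open>S\<close> even without \<open>s\<close>.\<close>
  have third: "\<exists>s1 \<in> S. s1 \<noteq> s \<and> s1 \<in> {y, z} \<union> N x"
    if z: "z \<in> V" "N z = N x" "z \<noteq> x" "z \<noteq> y" for z
  proof -
    \<comment> \<open>The three twins are distinct neighbors of \<open>a\<close>, so the degree
      bound \<open>c <= 3\<close> forces \<open>c = 3\<close> and leaves no room for others.\<close>
    have Na: "N a = {x, y, z} \<and> c = 3" if "a \<in> N x" for a
    proof -
      have aV: "a \<in> V" using that t N_subset by blast
      have sub: "{x, y, z} \<subseteq> N a"
        using that t z N_sym[of x a] N_sym[of y a] N_sym[of z a] by auto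
      have c3: "card {x, y, z} = 3" using t z by auto
      have "card {x, y, z} \<le> card (N a)"
        by (rule card_mono[OF finite_N[OF aV] sub])
      then have "card (N a) = 3" "c = 3" using c3 card_N[OF aV] c_le by auto
      then show ?thesis
        using card_subset_eq[OF finite_N[OF aV] sub] c3 by simp
    qed
    show ?thesis
    proof (cases "s = y")
      case True
      \<comment> \<open>For \<open>s = y\<close>, a vertex of \<open>S\<close> hitting
        \<open>x, z\<close> will do: it is not \<open>x\<close>, and \<open>y\<close> is neither
        \<open>z\<close> nor a neighbor of \<open>x\<close>.\<close>
      have "twins x z" using t z by (auto simp: twins_def)
      from hit[OF this] obtain s1 where "s1 \<in> S" "s1 \<in> {x, z} \<union> N x"
        unfolding hits_def by blast
      then show ?thesis
        using True t z(4) assms(3) N_irrefl[of y] by (intro bexI[of _ s1]) auto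
    next
      case False
      then have sN: "s \<in> N x" using s \<open>s \<noteq> x\<close> by auto
      have "card (N x) = 3" using Na[OF sN] t by auto
      \<comment> \<open>For \<open>s\<close> in \<open>N x\<close>, the other two neighbors
        \<open>a, b\<close> of \<open>x\<close> are themselves twins with neighborhood
        \<open>{x, y, z}\<close>. \<open>S\<close> must hit them, and \<open>s\<close> does
        not.\<close>
      then have "card (N x - {s}) = 2" using sN by simp
      then obtain a b where ab: "N x - {s} = {a, b}" "a \<noteq> b"
        unfolding card_2_iff by blast
      have aN: "a \<in> N x" and bN: "b \<in> N x" and as: "a \<noteq> s" "b \<noteq> s"
        using ab by blast+
      have "a \<in> V" "b \<in> V" using aN bN N_subset[of x] t by blast+
      moreover have "card (N a) = c" using Na[OF aN] t z by simp
      ultimately have "twins a b"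
        unfolding twins_def using Na[OF aN] Na[OF bN] ab(2) by metis
      from hit[OF this] obtain s1 where s1: "s1 \<in> S" "s1 \<in> {a, b} \<union> N a"
        unfolding hits_def by blast
      have "s1 \<noteq> s"
        using s1(2) as Na[OF aN] False \<open>s \<noteq> x\<close> sN z(1,2) N_irrefl[of z] by blast
      moreover have "s1 \<in> {y, z} \<union> N x"
        using s1 assms(3) aN bN Na[OF aN] by auto
      ultimately show ?thesis
        using s1(1) by blast
    qed
  qed
  have "hits (insert x (S - {s})) p q" if pq: "twins p q" for p q
  proof (rule ccontr)
    assume neg: "\<not> hits (insert x (S - {s})) p q"
    note t' = pq[unfolded twins_def]
    have x: "x \<notin> {p, q} \<union> N p" using neg by (auto simp: hits_def)
    have only: "s1 = s" if "s1 \<in> S" "s1 \<in> {p, q} \<union> N p" for s1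
      using neg that by (auto simp: hits_def)
    \<comment> \<open>Since \<open>s\<close> was the only vertex of \<open>S\<close> hitting
      \<open>p, q\<close>, the two pairs overlap in \<open>s\<close>. So \<open>p, q\<close> are
      \<open>y\<close> and a third twin, which contradicts \<open>third\<close>.\<close>
    then have "s \<in> {p, q} \<union> N p" using hit[OF pq] by (auto simp: hits_def)
    from twins_sharing_neighbor[OF xy pq x s(2) this]
    have N: "N p = N x" "y \<in> {p, q}" by auto
    obtain z where z: "z \<in> V" "N z = N x" "z \<noteq> x" "z \<noteq> y" "{p, q} = {y, z}"
    proof (cases "y = p")
      case True
      with that[of q] t' N x show thesis by auto
    next
      case False
      with that[of p] t' N x show thesis by auto
    qed
    from third[OF z(1-4)] only show False unfolding N(1) z(5) by blast
  qed
  moreover have "insert x (S - {s}) \<subseteq> V" using S t by (auto simp: hitting_set_def)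
  ultimately have "hitting_set (insert x (S - {s}))" by (simp add: hitting_set_def)
  then show thesis using s that by blast
qed

definition greedy :: "'a \<Rightarrow> 'a \<Rightarrow> 'a set \<Rightarrow> 'a set" where
  "greedy x y D = (if twins x y \<and> \<not> hits D x y then insert x D else D)"

text \<open>This is the invariant of the greedy algorithm. Once \<open>D\<close> is itself a hitting
  set, it makes \<open>D\<close> a smallest one, without a minimum hitting set ever being
  chosen.\<close>

definition extendable :: "'a set \<Rightarrow> bool" where
  "extendable D \<longleftrightarrow> D \<subseteq> V \<and> (\<forall>S. hitting_set S \<longrightarrow> (\<exists>S'. hitting_set S' \<and> D \<subseteq> S' \<and> card S' \<le> card S))"

lemma extendable_greedy:
  assumes "extendable D"
  shows "extendable (greedy x y D)"
proof (cases "twins x y \<and> \<not> hits D x y")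
  case True
  have "\<exists>S'. hitting_set S' \<and> insert x D \<subseteq> S' \<and> card S' \<le> card S" if S: "hitting_set S" for S
  proof -
    obtain S1 where S1: "hitting_set S1" "D \<subseteq> S1" "card S1 \<le> card S"
      using assms S unfolding extendable_def by blast
    show ?thesis
    proof (cases "x \<in> S1")
      case True
      then show ?thesis using S1 by auto
    next
      case False
      then obtain s where s: "s \<in> S1" "s \<in> {x, y} \<union> N x" "hitting_set (insert x (S1 - {s}))"
        using exchange[OF S1(1)] True by blast
      \<comment> \<open>\<open>D\<close> does not meet \<open>{x, y} \<union> N x\<close>, which
        contains \<open>s\<close>, so the exchange removes nothing from \<open>D\<close>.\<close>
      have "s \<notin> D" using s(2) True by (auto simp: hits_def)
      moreover have "finite S1"
        using S1(1) finite_V by (auto simp: hitting_set_def intro: finite_subset)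
      then have "card (insert x (S1 - {s})) = card S1"
        using s(1) False card_Suc_Diff1[of S1 s] by simp
      ultimately show ?thesis
        using S1 s(3) by (intro exI[of _ "insert x (S1 - {s})"]) auto
    qed
  qed
  then show ?thesis
    using True assms by (auto simp: extendable_def greedy_def twins_def)
qed (use assms in \<open>auto simp: greedy_def\<close>)

lemma greedy_mono: "D \<subseteq> greedy x y D"
  by (auto simp: greedy_def)

lemma hits_greedy: "twins x y \<Longrightarrow> hits (greedy x y D) x y"
  by (auto simp: greedy_def hits_def)

lemma extendable_optimal:
  assumes "extendable D" "\<And>x y. twins x y \<Longrightarrow> hits D x y"
  shows "(\<exists>S. hitting_set S \<and> card S \<le> k) \<longleftrightarrow> card D \<le> k"
proof
  assume "\<exists>S. hitting_set S \<and> card S \<le> k"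
  then obtain S where "hitting_set S" "D \<subseteq> S" "card S \<le> k"
    using assms(1) by (meson extendable_def order_trans)
  moreover have "finite S"
    using \<open>hitting_set S\<close> finite_V by (auto simp: hitting_set_def intro: finite_subset)
  ultimately show "card D \<le> k"
    using card_mono[of S D] by simp
next
  assume "card D \<le> k"
  moreover have "hitting_set D" using assms by (auto simp: hitting_set_def extendable_def)
  ultimately show "\<exists>S. hitting_set S \<and> card S \<le> k" by blast
qed

end

section \<open>Vertex deletion as a hitting set problem\<close>

lemma adjacency_lists_arc_iff:
  assumes "adjacency_lists G adj" "u < length adj"
  shows "(u, w) \<in> parcs G \<longleftrightarrow> w \<in> set (adj ! u)"
  using assms by (auto simp: adjacency_lists_def)

lemma bounded_degree_graph_adjacency_lists:
  assumes "pair_graph G" "adjacency_lists G adj" "max_degree (with_proj G) = c" "0 < c" "c \<le> 3"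
  shows "bounded_degree_graph {..<length adj} (\<lambda>v. set (adj ! v)) c"
proof -
  interpret pair_graph G by fact
  note arc = adjacency_lists_arc_iff[OF assms(2)]
  have V: "pverts G = {..<length adj}"
    using assms(2) by (simp add: adjacency_lists_def)
  have in_V: "w < length adj" if "v < length adj" "w \<in> set (adj ! v)" for v w
    using that arc[of v w] in_arcsD2[of v w] V by auto
  show ?thesis
  proof
    show "set (adj ! v) \<subseteq> {..<length adj}" if "v \<in> {..<length adj}" for v
      using that in_V by auto
    show "v \<in> set (adj ! w)" if "v \<in> {..<length adj}" "w \<in> set (adj ! v)" for v w
      using that in_V[of v w] arc[of v w] arc[of w v] graph_symmetric[of v w] by auto
    show "v \<notin> set (adj ! v)" if "v \<in> {..<length adj}" for v
      using that arc[of v v] no_loops[of "(v, v)"] by auto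
    show "card (set (adj ! v)) \<le> c" if "v \<in> {..<length adj}" for v
    proof -
      have "set (adj ! v) = snd ` out_arcs (with_proj G) v"
        using that arc[of v] by (force simp: out_arcs_def)
      then have "card (set (adj ! v)) \<le> out_degree (with_proj G) v"
        using card_image_le[of "out_arcs (with_proj G) v" snd] by (simp add: out_degree_def out_arcs_def)
      also have "\<dots> \<le> c"
        using that assms(3) V unfolding max_degree_def by (auto intro!: Max_ge)
      finally show ?thesis .
    qed
  qed (use assms in auto)
qed

lemma c_closed_vertex_deletion_iff_hitting_set:
  assumes "adjacency_lists G adj" "bounded_degree_graph {..<length adj} (\<lambda>v. set (adj ! v)) c"
  shows "c_closed_vertex_deletion c (with_proj G) k \<longleftrightarrow>
    (\<exists>S. bounded_degree_graph.hitting_set {..<length adj} (\<lambda>v. set (adj ! v)) c S \<and> card S \<le> k)"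
proof -
  define N where "N = (\<lambda>v. set (adj ! v))"
  define V where "V = {..<length adj}"
  interpret bounded_degree_graph V N c
    using assms(2) by (simp add: V_def N_def)
  have verts: "pverts G = V"
    using assms(1) by (simp add: adjacency_lists_def V_def)
  have "c_closed c (with_proj G \<restriction> (V - S)) \<longleftrightarrow> (\<forall>x y. twins x y \<longrightarrow> hits S x y)" for S
  proof -
    define A where "A = V - S"
    have dom: "u \<rightarrow>\<^bsub>with_proj G \<restriction> A\<^esub> w \<longleftrightarrow> w \<in> A \<and> w \<in> N u" if "u \<in> A" for u w
      using adjacency_lists_arc_iff[OF assms(1), of u w] that
      by (force simp: arcs_ends_def arc_to_ends_def induce_subgraph_def A_def V_def N_def)
    have cn: "common_neighbors (with_proj G \<restriction> A) u v = A \<inter> N u \<inter> N v"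
      if "u \<in> A" "v \<in> A" for u v
      using that by (auto simp: common_neighbors_def dom)
    show ?thesis unfolding A_def[symmetric]
    proof (intro iffI allI impI)
      fix x y assume cl: "c_closed c (with_proj G \<restriction> A)" and t: "twins x y"
      show "hits S x y"
      proof (rule ccontr)
        assume nh: "\<not> hits S x y"
        \<comment> \<open>An unhit pair survives the deletion together with all its \<open>c\<close>
          common neighbors.\<close>
        have A: "x \<in> A" "y \<in> A" "N x \<subseteq> A"
          using nh t N_subset[of x] by (auto simp: A_def hits_def twins_def)
        have "y \<notin> N x" using t N_irrefl[of y] by (auto simp: twins_def)
        then have "card (common_neighbors (with_proj G \<restriction> A) x y) \<le> c - 1"
          using cl A(1,2) t dom[OF A(1), of y] unfolding c_closed_def twins_def by simp
        moreover have "common_neighbors (with_proj G \<restriction> A) x y = N x"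
          using cn[OF A(1,2)] A(3) t by (auto simp: twins_def)
        ultimately show False using t c_pos by (auto simp: twins_def)
      qed
    next
      assume h: "\<forall>x y. twins x y \<longrightarrow> hits S x y"
      have False if uv: "u \<in> A" "v \<in> A" "u \<noteq> v" and big: "\<not> card (A \<inter> N u \<inter> N v) \<le> c - 1" for u v
      proof -
        define C where "C = A \<inter> N u \<inter> N v"
        have C: "c \<le> card C" using big by (simp add: C_def)
        have V: "u \<in> V" "v \<in> V" using uv by (auto simp: A_def)
        \<comment> \<open>At least \<open>c\<close> common neighbors exhaust both neighborhoods,
          which have at most \<open>c\<close> elements. Hence \<open>u, v\<close> are twins whose
          neighbors all avoid \<open>S\<close>.\<close>
        have eq: "N x = C \<and> card C = c" if "x \<in> {u, v}" for x
        proof -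
          have x: "x \<in> V" using V that by auto
          have sub: "C \<subseteq> N x" using that by (auto simp: C_def)
          have "card (N x) \<le> card C" using card_N[OF x] C by simp
          then have "C = N x" by (rule card_seteq[OF finite_N[OF x] sub])
          then show ?thesis using card_N[OF x] C by simp
        qed
        have "twins u v" using eq[of u] eq[of v] V uv by (auto simp: twins_def)
        then have "hits S u v" using h by blast
        moreover have "C \<subseteq> A" by (auto simp: C_def)
        ultimately show False using eq[of u] uv by (auto simp: hits_def A_def)
      qed
      then show "c_closed c (with_proj G \<restriction> A)"
        using cn by (auto simp: c_closed_def)
    qed
  qed
  then show ?thesis
    by (auto simp: c_closed_vertex_deletion_def hitting_set_def verts V_def[symmetric] N_def[symmetric])
qed

section \<open>The program\<close>

abbreviation (input) num_deleted :: nat where "num_deleted \<equiv> 0"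
abbreviation (input) num_verts :: nat where "num_verts \<equiv> 1"
abbreviation (input) budget :: nat where "budget \<equiv> 2"
abbreviation (input) counter :: nat where "counter \<equiv> 3"
abbreviation (input) position :: nat where "position \<equiv> 4"
abbreviation (input) start_base :: nat where "start_base \<equiv> 5"
abbreviation (input) mark_base :: nat where "mark_base \<equiv> 6"
abbreviation (input) temp :: nat where "temp \<equiv> 7"
abbreviation (input) current :: nat where "current \<equiv> 8"

text \<open>Nested to the left, so that a sum needs just one scratch cell beyond those of its
  summands, however many there are.\<close>

definition total :: "expr list \<Rightarrow> expr" where
  "total es = foldl Plus (Lit 0) es"

text \<open>The heap holds a copy of the adjacency lists, then a table with the start of each list,
  then the marks of deleted vertices. Each list is preceded by its length, whence the
  \<open>Suc i\<close> in \<open>neighbor_of\<close>.\<close>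

definition start_of :: "expr \<Rightarrow> expr" where
  "start_of a = Heap (Plus (Var start_base) a)"

definition degree_of :: "expr \<Rightarrow> expr" where
  "degree_of a = Heap (start_of a)"

definition neighbor_of :: "expr \<Rightarrow> nat \<Rightarrow> expr" where
  "neighbor_of a i = Heap (Plus (start_of a) (Lit (Suc i)))"

definition mark_of :: "expr \<Rightarrow> expr" where
  "mark_of a = Heap (Plus (Var mark_base) a)"

text \<open>Under truncated subtraction the two differences add up to the distance of
  \<open>a\<close> and \<open>b\<close>, so the result is the 0/1 indicator of equality.\<close>

definition equality :: "expr \<Rightarrow> expr \<Rightarrow> expr" where
  "equality a b = Minus (Lit 1) (Plus (Minus a b) (Minus b a))"

text \<open>
  With \<open>u\<close> the current vertex and \<open>w\<close> the \<open>j\<close>-th neighbor of the first neighbor of \<open>u\<close>, the value is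
  \<open>0\<close> iff \<open>w\<close> exists, \<open>u\<close> and \<open>w\<close> are twins of degree \<open>c\<close>, and neither they nor their neighbors are
  marked. If some vertex has too few neighbors, then the terms that refer to the missing ones are
  meaningless, but one of the degree terms is positive.
\<close>

definition violations :: "nat \<Rightarrow> nat \<Rightarrow> expr" where
  "violations c j = (let u = Var current; a = neighbor_of u 0; w = neighbor_of a j in
    total [Minus (Lit c) (degree_of u), Minus (Lit (Suc j)) (degree_of a), Minus (Lit c) (degree_of w),
      mark_of u, mark_of w, total (map (\<lambda>i. mark_of (neighbor_of u i)) [0..<c]), equality u w,
      Minus (Lit c) (total (map (\<lambda>i. total (map (\<lambda>l. equality (neighbor_of u i) (neighbor_of w l))
        [0..<c])) [0..<c]))])"

definition decrement :: stmt where
  "decrement = Assign counter (Minus (Var counter) (Lit 1))"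

definition copy_input :: "stmt list" where
  "copy_input = [Input temp, Write (Var position) (Var temp), Assign position (Plus (Var position) (Lit 1))]"

definition copy_body :: "nat \<Rightarrow> stmt list" where
  "copy_body c = concat (replicate (Suc c) copy_input) @ [decrement]"

text \<open>\<open>position\<close> points at the length entry of the current list; adding this
  entry and one leads to the next list.\<close>

definition index_body :: "stmt list" where
  "index_body = [Write (Plus (Var start_base) (Var current)) (Var position),
    Assign position (Plus (Plus (Var position) (Heap (Var position))) (Lit 1)),
    Assign current (Plus (Var current) (Lit 1)), decrement]"

text \<open>\<open>temp\<close> is 1 iff the current vertex must be deleted; adding it to mark and
  count replaces a branch. Marks stay 0 or 1, because an existing mark makes
  \<open>violations\<close> positive.\<close>

definition greedy_step :: "nat \<Rightarrow> nat \<Rightarrow> stmt list" where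
  "greedy_step c j = [Assign temp (Minus (Lit 1) (violations c j)),
    Write (Plus (Var mark_base) (Var current)) (Plus (mark_of (Var current)) (Var temp)),
    Assign num_deleted (Plus (Var num_deleted) (Var temp))]"

definition greedy_body :: "nat \<Rightarrow> stmt list" where
  "greedy_body c = concat (map (greedy_step c) [0..<c]) @
    [Assign current (Plus (Var current) (Lit 1)), decrement]"

definition init_copy :: "stmt list" where
  "init_copy = [Input num_verts, Input budget, Assign counter (Var num_verts)]"

definition init_index :: "stmt list" where
  "init_index = [Assign start_base (Var position), Assign mark_base (Plus (Var start_base) (Var num_verts)),
    Assign counter (Var num_verts), Assign position (Lit 0), Assign current (Lit 0)]"

definition init_greedy :: "stmt list" where
  "init_greedy = [Assign counter (Var num_verts), Assign current (Lit 0)]"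

text \<open>Truncated subtraction yields 1 iff \<open>num_deleted <= budget\<close>; variable 0 is
  the answer cell.\<close>

definition finish :: "stmt list" where
  "finish = [Assign 0 (Minus (Lit 1) (Minus (Var num_deleted) (Var budget)))]"

text \<open>
  As a vertex has at most \<open>c\<close> neighbors, \<open>n * (c + 1)\<close> read operations exhaust the adjacency lists;
  reading beyond the end of the tape only yields zeros.
\<close>

definition program :: "nat \<Rightarrow> com list" where
  "program c = [Block init_copy, Loop counter (copy_body c), Block init_index, Loop counter index_body,
    Block init_greedy, Loop counter (greedy_body c), Block finish]"

text \<open>The sum follows the times in the rules of \<open>runs\<close> term by term, down to the
  0 of \<open>runs_Nil\<close>, so that the rules apply directly.\<close>

definition running_time :: "nat \<Rightarrow> nat \<Rightarrow> nat" where
  "running_time c n =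
    length (compile_block init_copy) + (n * (length (compile_block (copy_body c)) + 1) +
    (length (compile_block init_index) + (n * (length (compile_block index_body) + 1) +
    (length (compile_block init_greedy) + (n * (length (compile_block (greedy_body c)) + 1) +
    (length (compile_block finish) + 0))))))"

section \<open>Evaluation, scratch space and running time\<close>

lemma eval_total: "eval (total es) v h = sum_list (map (\<lambda>a. eval a v h) es)"
proof -
  have "eval (foldl Plus a es) v h = eval a v h + sum_list (map (\<lambda>a. eval a v h) es)" for a
    by (induction es arbitrary: a) auto
  then show ?thesis by (simp add: total_def)
qed

lemma fits_total: "fits r (total es) \<longleftrightarrow> r < heap_base \<and> list_all (fits (Suc r)) es"
proof -
  have "fits r (foldl Plus a es) \<longleftrightarrow> fits r a \<and> list_all (fits (Suc r)) es" for a
    by (induction es arbitrary: a) auto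
  then show ?thesis by (simp add: total_def)
qed

lemma eval_equality: "eval (equality a b) v h = of_bool (eval a v h = eval b v h)"
  by (auto simp: equality_def)

lemma fits_program: "list_all fits_com (program c)"
  by (simp add: program_def init_copy_def copy_body_def copy_input_def init_index_def index_body_def
      init_greedy_def greedy_body_def greedy_step_def finish_def decrement_def violations_def Let_def
      fits_total equality_def mark_of_def neighbor_of_def degree_of_def start_of_def
      list_all_iff num_vars_def heap_base_def)

lemma running_time_bigo: "(\<lambda>n. real (running_time c n)) \<in> O(\<lambda>n. real n)"
proof -
  \<comment> \<open>The time is affine in \<open>n\<close>, so for \<open>n >= 1\<close> its
    constant part can be charged to the slope.\<close>
  have "running_time c n \<le> running_time c 1 * n" if "0 < n" for n
    using that unfolding running_time_def by (cases n) (auto simp: algebra_simps)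
  then have "real (running_time c n) \<le> real (running_time c 1) * real n" if "0 < n" for n
    using that by (metis of_nat_le_iff of_nat_mult)
  then show ?thesis
    by (intro bigoI[of _ "real (running_time c 1)"])
      (auto intro: eventually_mono[OF eventually_gt_at_top[of 0]])
qed

lemma loop_invariant:
  assumes "I 0 s" "\<And>i s. i < m \<Longrightarrow> I i s \<Longrightarrow> I (Suc i) (run b s)" "i \<le> m"
  shows "I i ((run b ^^ i) s)"
  using assms(3) by (induction i) (use assms(1,2) in auto)

text \<open>The default in \<open>nth_default 0\<close> reflects that an exhausted tape delivers
  zeros.\<close>

lemma run_copy_input:
  "\<exists>t. run (concat (replicate m copy_input)) (v, h, xs) =
    (v(position := v position + m, temp := t),
     \<lambda>i. if v position \<le> i \<and> i < v position + m then nth_default 0 xs (i - v position) else h i,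
     drop m xs)"
proof (induction m arbitrary: v h xs)
  case 0
  then show ?case by (auto intro!: exI[of _ "v temp"])
next
  case (Suc m)
  define y where "y = nth_default 0 xs 0"
  have y: "(case xs of [] \<Rightarrow> 0 | z # _ \<Rightarrow> z) = y"
    by (cases xs) (auto simp: y_def nth_default_def)
  have tl: "nth_default 0 (tl xs) i = nth_default 0 xs (Suc i)" for i
    by (cases xs) (auto simp: nth_default_def)
  define v' where "v' = v(temp := y, position := Suc (v position))"
  have "run (concat (replicate (Suc m) copy_input)) (v, h, xs) =
      run (concat (replicate m copy_input)) (v', h(v position := y), tl xs)"
    by (simp add: copy_input_def y v'_def)
  then obtain t where t: "run (concat (replicate (Suc m) copy_input)) (v, h, xs) =
      (v'(position := v' position + m, temp := t),
       \<lambda>i. if v' position \<le> i \<and> i < v' position + m then nth_default 0 (tl xs) (i - v' position)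
         else (h(v position := y)) i, drop m (tl xs))"
    using Suc[of v' "h(v position := y)" "tl xs"] by (elim exE) (rule that, simp only:)
  have "v'(position := v' position + m, temp := t) = v(position := v position + Suc m, temp := t)"
    by (auto simp: v'_def fun_eq_iff)
  moreover have "(if v' position \<le> i \<and> i < v' position + m then nth_default 0 (tl xs) (i - v' position)
         else (h(v position := y)) i) =
      (if v position \<le> i \<and> i < v position + Suc m then nth_default 0 xs (i - v position) else h i)" for i
    by (auto simp: v'_def y_def tl Suc_diff_le[symmetric])
  ultimately show ?case
    using t by (intro exI[of _ t]) (simp only: drop_Suc)
qed

text \<open>Each inner sum is 0 or 1 because \<open>ys\<close> has no repetitions. So the double sum
  in \<open>violations\<close> counts common neighbors.\<close>

lemma sum_list_equal_card_inter:
  assumes "distinct xs" "distinct ys"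
  shows "sum_list (map (\<lambda>x. sum_list (map (\<lambda>y. of_bool (x = y) :: nat) ys)) xs) = card (set xs \<inter> set ys)"
proof -
  have "sum_list (map (\<lambda>y. of_bool (x = y) :: nat) ys) = of_bool (x \<in> set ys)" for x
    using assms(2) by (induction ys) auto
  then have "sum_list (map (\<lambda>x. sum_list (map (\<lambda>y. of_bool (x = y) :: nat) ys)) xs) =
      (\<Sum>x \<in> set xs. of_bool (x \<in> set ys))"
    using assms(1) by (simp add: sum_list_distinct_conv_sum_set)
  also have "\<dots> = card (set xs \<inter> set ys)"
    by (simp add: sum.inter_restrict[symmetric] of_bool_def flip: card_eq_sum)
  finally show ?thesis .
qed

section \<open>Memory layout and the violation test\<close>

locale adjacency_list_graph = bounded_degree_graph "{..<length adj}" "\<lambda>v. set (adj ! v)" c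
  for adj :: "nat list list" and c :: nat +
  assumes distinct_adj: "v < length adj \<Longrightarrow> distinct (adj ! v)"
    and adj_nonempty: "0 < length adj"
begin

definition tape_tail :: "nat list list \<Rightarrow> nat list" where
  "tape_tail as = concat (map (\<lambda>ns. length ns # ns) as)"

definition offset :: "nat \<Rightarrow> nat" where
  "offset v = length (tape_tail (take v adj))"

text \<open>The copy phase fills \<open>c + 1\<close> cells per vertex, enough for a length and at
  most \<open>c\<close> neighbors; the table of starts comes next.\<close>

definition starts :: nat where "starts = length adj * Suc c"

definition marks :: nat where "marks = starts + length adj"

lemma length_adj_le: "v < length adj \<Longrightarrow> length (adj ! v) \<le> c"
  using card_N[of v] distinct_card[OF distinct_adj[of v]] by simp

lemma neighbor_less: "v < length adj \<Longrightarrow> i < length (adj ! v) \<Longrightarrow> adj ! v ! i < length adj"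
  using N_subset[of v] nth_mem[of i "adj ! v"] by blast

lemma offset_0: "offset 0 = 0"
  by (simp add: offset_def tape_tail_def)

lemma offset_Suc: "v < length adj \<Longrightarrow> offset (Suc v) = Suc (offset v + length (adj ! v))"
  by (simp add: offset_def tape_tail_def take_Suc_conv_app_nth)

lemma offset_le: "v \<le> length adj \<Longrightarrow> offset v \<le> v * Suc c"
proof (induction v)
  case (Suc v)
  then show ?case using offset_Suc[of v] length_adj_le[of v] by simp
qed (simp add: offset_0)

lemma offset_less: "v < length adj \<Longrightarrow> offset v + length (adj ! v) < starts"
  using offset_le[of "Suc v"] offset_Suc[of v] mult_le_mono1[of "Suc v" "length adj" "Suc c"]
  unfolding starts_def by linarith

lemma tape_tail_nth:
  assumes "v < length adj" "i \<le> length (adj ! v)"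
  shows "nth_default 0 (tape_tail adj) (offset v + i) = (length (adj ! v) # adj ! v) ! i"
proof -
  have "tape_tail adj = tape_tail (take v adj) @ (length (adj ! v) # adj ! v) @ tape_tail (drop (Suc v) adj)"
    using arg_cong[OF id_take_nth_drop[OF assms(1)], of tape_tail] by (simp add: tape_tail_def)
  then show ?thesis
    using assms(2) by (cases i) (auto simp: nth_default_def nth_append offset_def)
qed

definition layout :: "(nat \<Rightarrow> nat) \<Rightarrow> nat set \<Rightarrow> bool" where
  "layout h D \<longleftrightarrow> (\<forall>v < length adj. h (starts + v) = offset v \<and> h (offset v) = length (adj ! v) \<and>
    (\<forall>i < length (adj ! v). h (offset v + Suc i) = adj ! v ! i) \<and> h (marks + v) = of_bool (v \<in> D))"

lemma layout_mark:
  assumes "layout h D" "u < length adj"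
  shows "layout (h(marks + u := 1)) (insert u D)"
  using assms offset_less by (force simp: layout_def marks_def)

lemma eval_violations:
  fixes j :: nat
  assumes h: "layout h D" and v: "v start_base = starts" "v mark_base = marks" "v current = u"
    and u: "u < length adj"
  defines "w \<equiv> adj ! (adj ! u ! 0) ! j"
  shows "eval (violations c j) v h = 0 \<longleftrightarrow>
    length (adj ! u) = c \<and> j < length (adj ! (adj ! u ! 0)) \<and> twins u w \<and> \<not> hits D u w"
proof -
  have degree: "eval (degree_of a) v h = length (adj ! x)" if "eval a v h = x" "x < length adj" for a x
    using h v that by (simp add: layout_def degree_of_def start_of_def)
  have neighbor: "eval (neighbor_of a i) v h = adj ! x ! i"
    if "eval a v h = x" "x < length adj" "i < length (adj ! x)" for a x i
    using h v that by (simp add: layout_def neighbor_of_def start_of_def)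
  have mark: "eval (mark_of a) v h = of_bool (x \<in> D)" if "eval a v h = x" "x < length adj" for a x
    using h v that by (simp add: layout_def mark_of_def)
  have cu: "eval (Var current) v h = u" using v by simp
  let ?u = "Var current"
  let ?a = "neighbor_of ?u 0"
  let ?w = "neighbor_of ?a j"
  note du = degree[OF cu u]
  show ?thesis
  proof (cases "length (adj ! u) = c \<and> j < length (adj ! (adj ! u ! 0))")
    case False
    have "c - eval (degree_of ?u) v h \<noteq> 0 \<or> Suc j - eval (degree_of ?a) v h \<noteq> 0"
    proof (cases "length (adj ! u) = c")
      case True
      then have "eval (degree_of ?a) v h = length (adj ! (adj ! u ! 0))"
        using neighbor[OF cu u] neighbor_less[OF u] c_pos by (intro degree) auto
      then show ?thesis using True False by auto
    next
      case False
      then show ?thesis using du length_adj_le[OF u] by auto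
    qed
    then show ?thesis
      using False by (auto simp: violations_def Let_def eval_total)
  next
    case True
    define a where "a = adj ! u ! 0"
    have a: "eval ?a v h = a" "a < length adj"
      using True neighbor[OF cu u] neighbor_less[OF u] c_pos by (auto simp: a_def)
    have w: "eval ?w v h = w" "w < length adj"
      using True neighbor[OF a] neighbor_less[OF a(2)] by (auto simp: a_def w_def)
    have cardw: "card (set (adj ! w)) = length (adj ! w)" and cardu: "card (set (adj ! u)) = c"
      using distinct_card[OF distinct_adj] u w True by auto
    show ?thesis
    proof (cases "length (adj ! w) = c")
      case False
      then have "c - eval (degree_of ?w) v h \<noteq> 0"
        using degree[OF w] length_adj_le[OF w(2)] by simp
      moreover have "\<not> twins u w"
        using cardw cardu False by (auto simp: twins_def)
      ultimately show ?thesis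
        by (auto simp: violations_def Let_def eval_total)
    next
      case lw: True
      have nu: "eval (neighbor_of ?u i) v h = adj ! u ! i" if "i < c" for i
        using neighbor[OF cu u] True that by simp
      have nw: "eval (neighbor_of ?w i) v h = adj ! w ! i" if "i < c" for i
        using neighbor[OF w] lw that by simp
      have map_u: "map (\<lambda>i. f (adj ! u ! i)) [0..<c] = map f (adj ! u)" for f :: "nat \<Rightarrow> nat"
        using True by (auto intro: nth_equalityI)
      have map_w: "map (\<lambda>i. f (adj ! w ! i)) [0..<c] = map f (adj ! w)" for f :: "nat \<Rightarrow> nat"
        using lw by (auto intro: nth_equalityI)
      have mu: "eval (total (map (\<lambda>i. mark_of (neighbor_of ?u i)) [0..<c])) v h
          = sum_list (map (\<lambda>x. of_bool (x \<in> D)) (adj ! u))"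
      proof -
        have "eval (mark_of (neighbor_of ?u i)) v h = of_bool (adj ! u ! i \<in> D)" if "i < c" for i
          using mark[OF nu[OF that]] neighbor_less[OF u, of i] True that by simp
        then have "map (\<lambda>i. eval (mark_of (neighbor_of ?u i)) v h) [0..<c] = map (\<lambda>x. of_bool (x \<in> D)) (adj ! u)"
          unfolding map_u[of "\<lambda>x. of_bool (x \<in> D)", symmetric] by (intro map_cong) auto
        then show ?thesis
          by (simp add: eval_total comp_def)
      qed
      have eq: "eval (total (map (\<lambda>i. total (map (\<lambda>l. equality (neighbor_of ?u i) (neighbor_of ?w l))
          [0..<c])) [0..<c])) v h = card (set (adj ! u) \<inter> set (adj ! w))"
      proof -
        have inner: "eval (total (map (\<lambda>l. equality (neighbor_of ?u i) (neighbor_of ?w l)) [0..<c])) v h =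
            sum_list (map (\<lambda>y. of_bool (adj ! u ! i = y)) (adj ! w))" if "i < c" for i
        proof -
          have "map (\<lambda>l. eval (equality (neighbor_of ?u i) (neighbor_of ?w l)) v h) [0..<c] =
              map (\<lambda>y. of_bool (adj ! u ! i = y)) (adj ! w)"
            unfolding map_w[of "\<lambda>y. of_bool (adj ! u ! i = y)", symmetric]
            by (intro map_cong) (auto simp: eval_equality nu[OF that] nw)
          then show ?thesis by (simp add: eval_total comp_def)
        qed
        have "map (\<lambda>i. eval (total (map (\<lambda>l. equality (neighbor_of ?u i) (neighbor_of ?w l)) [0..<c])) v h)
            [0..<c] = map (\<lambda>x. sum_list (map (\<lambda>y. of_bool (x = y)) (adj ! w))) (adj ! u)"
          unfolding map_u[of "\<lambda>x. sum_list (map (\<lambda>y. of_bool (x = y)) (adj ! w))", symmetric]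
          by (intro map_cong) (auto simp: inner)
        then show ?thesis
          using sum_list_equal_card_inter[OF distinct_adj[OF u] distinct_adj[OF w(2)]]
          by (subst eval_total) (simp add: comp_def)
      qed
      \<comment> \<open>Both neighborhoods have exactly \<open>c\<close> elements here, so the last
        term of \<open>violations\<close> vanishes iff they coincide.\<close>
      have "c \<le> card (set (adj ! u) \<inter> set (adj ! w)) \<longleftrightarrow> set (adj ! u) = set (adj ! w)"
      proof
        assume *: "c \<le> card (set (adj ! u) \<inter> set (adj ! w))"
        have "set (adj ! u) \<inter> set (adj ! w) = set (adj ! u)"
          using * cardu by (intro card_seteq) auto
        moreover have "set (adj ! u) \<inter> set (adj ! w) = set (adj ! w)"
          using * cardw lw by (intro card_seteq) auto
        ultimately show "set (adj ! u) = set (adj ! w)" by simp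
      qed (use cardu in auto)
      moreover have "sum_list (map (\<lambda>x. of_bool (x \<in> D)) (adj ! u)) = (0::nat) \<longleftrightarrow> set (adj ! u) \<inter> D = {}"
        by auto
      ultimately show ?thesis
        using True lw u w(2) cardu
        by (auto simp: violations_def Let_def eval_total[of "_ # _"] mu eq eval_equality du
            degree[OF a] degree[OF w] mark[OF cu u] mark[OF w] w(1) cu[simplified] v a_def twins_def hits_def)
    qed
  qed
qed

section \<open>The greedy phase\<close>

lemma run_greedy_step:
  fixes j :: nat
  assumes h: "layout h D" and v: "v start_base = starts" "v mark_base = marks" "v current = u"
    and u: "u < length adj" and card: "v num_deleted = card D" and fin: "finite D"
  defines "w \<equiv> adj ! (adj ! u ! 0) ! j"
  defines "D' \<equiv> (if length (adj ! u) = c \<and> j < length (adj ! (adj ! u ! 0)) then greedy u w D else D)"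
  shows "\<exists>t h'. run (greedy_step c j) (v, h, xs) = (v(temp := t, num_deleted := card D'), h', xs) \<and>
    layout h' D'"
proof -
  note z = eval_violations[OF h v u, of j, folded w_def]
  have mark: "h (marks + u) = of_bool (u \<in> D)"
    using h u by (simp add: layout_def)
  show ?thesis
  proof (cases "eval (violations c j) v h = 0")
    case True
    then have D': "D' = insert u D" "u \<notin> D"
      using z by (auto simp: D'_def greedy_def hits_def)
    have "run (greedy_step c j) (v, h, xs) =
        (v(temp := 1, num_deleted := card D'), h(marks + u := 1), xs)"
      using True D' mark v card fin by (simp add: greedy_step_def mark_of_def)
    then show ?thesis
      using layout_mark[OF h u] D' by blast
  next
    case False
    then have D': "D' = D"
      using z by (auto simp: D'_def greedy_def)
    have "h(marks + u := h (marks + u)) = h" by simp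
    then have "run (greedy_step c j) (v, h, xs) = (v(temp := 0, num_deleted := card D'), h, xs)"
      using False D' v card by (simp add: greedy_step_def mark_of_def)
    then show ?thesis
      using h D' by blast
  qed
qed

definition greedy_inv :: "nat \<Rightarrow> nat \<Rightarrow> nat \<Rightarrow> nat set \<Rightarrow> state \<Rightarrow> bool" where
  "greedy_inv k u m D s \<longleftrightarrow> (case s of (v, h, xs) \<Rightarrow>
    layout h D \<and> extendable D \<and> v num_deleted = card D \<and> v budget = k \<and> v counter = m \<and>
    v start_base = starts \<and> v mark_base = marks \<and> v current = u)"

text \<open>The deleted set only grows, so pairs hit at an earlier candidate stay hit. The
  \<open>min\<close> restricts the claim to candidates that exist.\<close>

lemma run_greedy_steps:
  assumes "greedy_inv k u m D s" "u < length adj" "length (adj ! u) = c \<Longrightarrow> a = adj ! u ! 0"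
  shows "\<exists>D'. D \<subseteq> D' \<and> greedy_inv k u m D' (run (concat (map (greedy_step c) [0..<j])) s) \<and>
    (length (adj ! u) = c \<longrightarrow>
      (\<forall>l < min j (length (adj ! a)). twins u (adj ! a ! l) \<longrightarrow> hits D' u (adj ! a ! l)))"
proof (induction j)
  case 0
  then show ?case using assms by auto
next
  case (Suc j)
  let ?r = "run (concat (map (greedy_step c) [0..<j])) s"
  obtain D1 where D1: "D \<subseteq> D1" "greedy_inv k u m D1 ?r"
    and hit: "\<And>l. length (adj ! u) = c \<Longrightarrow> l < j \<Longrightarrow> l < length (adj ! a) \<Longrightarrow>
      twins u (adj ! a ! l) \<Longrightarrow> hits D1 u (adj ! a ! l)"
    using Suc by auto
  obtain v h xs where r: "?r = (v, h, xs)" by (cases ?r)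
  have inv: "layout h D1" "v start_base = starts" "v mark_base = marks" "v current = u"
      "v num_deleted = card D1" "v budget = k" "v counter = m" "extendable D1"
    using D1(2) r by (auto simp: greedy_inv_def)
  have fin: "finite D1"
    using inv(8) finite_subset[of D1] by (auto simp: extendable_def)
  define D' where "D' = (if length (adj ! u) = c \<and> j < length (adj ! (adj ! u ! 0))
    then greedy u (adj ! (adj ! u ! 0) ! j) D1 else D1)"
  have sub: "D1 \<subseteq> D'" using greedy_mono by (simp add: D'_def)
  have ext: "extendable D'" using extendable_greedy[OF inv(8)] inv(8) by (simp add: D'_def)
  obtain t h' where th: "run (greedy_step c j) (v, h, xs) = (v(temp := t, num_deleted := card D'), h', xs)"
    "layout h' D'"
    using run_greedy_step[OF inv(1-4) assms(2) inv(5) fin] unfolding D'_def by blast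
  have "greedy_inv k u m D' (run (concat (map (greedy_step c) [0..<Suc j])) s)"
    using th r inv ext by (simp add: greedy_inv_def)
  moreover have "hits D' u (adj ! a ! l)"
    if "length (adj ! u) = c" "l < Suc j" "l < length (adj ! a)" "twins u (adj ! a ! l)" for l
  proof (cases "l = j")
    case True
    then show ?thesis
      using that assms(3) hits_greedy[of u "adj ! a ! l" D1] by (simp add: D'_def)
  next
    case False
    then show ?thesis
      using that hit[of l] hits_mono[OF _ sub] by simp
  qed
  ultimately show ?case
    using D1(1) sub by (intro exI[of _ D']) auto
qed

text \<open>A twin of \<open>u\<close> is adjacent to every neighbor of \<open>u\<close>, in
  particular to the first, which exists since \<open>c > 0\<close>. So scanning one list of at most
  \<open>c\<close> entries finds all twins.\<close>

lemma twin_of_first_neighbor: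
  assumes "twins u y"
  shows "length (adj ! u) = c \<and> (\<exists>l < length (adj ! (adj ! u ! 0)). adj ! (adj ! u ! 0) ! l = y)"
proof -
  have t: "u < length adj" "y < length adj" "set (adj ! u) = set (adj ! y)" "card (set (adj ! u)) = c"
    using assms by (auto simp: twins_def)
  have len: "length (adj ! u) = c"
    using distinct_card[OF distinct_adj[OF t(1)]] t(4) by simp
  then have "adj ! u ! 0 \<in> set (adj ! y)"
    using c_pos t(3) nth_mem[of 0 "adj ! u"] by simp
  then have "y \<in> set (adj ! (adj ! u ! 0))"
    using N_sym[of y] t(2) by simp
  then show ?thesis using len by (auto simp: in_set_conv_nth)
qed

definition greedy_phase_inv :: "nat \<Rightarrow> nat \<Rightarrow> state \<Rightarrow> bool" where
  "greedy_phase_inv k i s \<longleftrightarrow>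
    (\<exists>D. greedy_inv k i (length adj - i) D s \<and> (\<forall>x < i. \<forall>y. twins x y \<longrightarrow> hits D x y))"

lemma greedy_phase_inv_step:
  assumes "i < length adj" "greedy_phase_inv k i s"
  shows "greedy_phase_inv k (Suc i) (run (greedy_body c) s)"
proof -
  obtain D where D: "greedy_inv k i (length adj - i) D s" "\<And>x y. x < i \<Longrightarrow> twins x y \<Longrightarrow> hits D x y"
    using assms(2) by (auto simp: greedy_phase_inv_def)
  define a where "a = adj ! i ! 0"
  let ?r = "run (concat (map (greedy_step c) [0..<c])) s"
  obtain D' where D': "D \<subseteq> D'" "greedy_inv k i (length adj - i) D' ?r"
    and hit: "\<And>l. length (adj ! i) = c \<Longrightarrow> l < c \<Longrightarrow> l < length (adj ! a) \<Longrightarrow>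
      twins i (adj ! a ! l) \<Longrightarrow> hits D' i (adj ! a ! l)"
    using run_greedy_steps[OF D(1) assms(1) a_def, of c] by auto
  have "hits D' x y" if x: "x < Suc i" and t: "twins x y" for x y
  proof (cases "x = i")
    case True
    then obtain l where l: "length (adj ! i) = c" "l < length (adj ! a)" "adj ! a ! l = y"
      using twin_of_first_neighbor[OF t] by (auto simp: a_def)
    have "a < length adj"
      using neighbor_less[OF assms(1), of 0] l(1) c_pos by (simp add: a_def)
    \<comment> \<open>By the degree bound, \<open>c\<close> greedy steps reach every entry of the
      list of \<open>a\<close>.\<close>
    then have "l < c" using length_adj_le[of a] l(2) by simp
    then show ?thesis using hit[of l] l t True by simp
  next
    case False
    then show ?thesis using D(2)[of x y] hits_mono[OF _ D'(1)] x t by simp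
  qed
  moreover have "greedy_inv k (Suc i) (length adj - Suc i) D' (run (greedy_body c) s)"
    using D'(2) by (cases ?r) (auto simp: greedy_inv_def greedy_body_def decrement_def)
  ultimately show ?thesis
    unfolding greedy_phase_inv_def by blast
qed

section \<open>The copy and index phases\<close>

definition copy_inv :: "nat \<Rightarrow> nat \<Rightarrow> state \<Rightarrow> bool" where
  "copy_inv k i s \<longleftrightarrow> (case s of (v, h, xs) \<Rightarrow>
    v num_deleted = 0 \<and> v num_verts = length adj \<and> v budget = k \<and> v counter = length adj - i \<and>
    v position = i * Suc c \<and> xs = drop (i * Suc c) (tape_tail adj) \<and>
    h = (\<lambda>j. if j < i * Suc c then nth_default 0 (tape_tail adj) j else 0))"

lemma copy_inv_step:
  assumes "copy_inv k i s"
  shows "copy_inv k (Suc i) (run (copy_body c) s)"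
proof -
  obtain v h xs where s: "s = (v, h, xs)" by (cases s)
  have inv: "v num_deleted = 0" "v num_verts = length adj" "v budget = k" "v counter = length adj - i"
    "v position = i * Suc c" "xs = drop (i * Suc c) (tape_tail adj)"
    "h = (\<lambda>j. if j < i * Suc c then nth_default 0 (tape_tail adj) j else 0)"
    using assms s by (auto simp: copy_inv_def)
  obtain t where t: "run (concat (replicate (Suc c) copy_input)) (v, h, xs) =
    (v(position := v position + Suc c, temp := t),
     \<lambda>j. if v position \<le> j \<and> j < v position + Suc c then nth_default 0 xs (j - v position) else h j,
     drop (Suc c) xs)"
    using run_copy_input by blast
  have "(\<lambda>j. if v position \<le> j \<and> j < v position + Suc c then nth_default 0 xs (j - v position) else h j) =
      (\<lambda>j. if j < Suc i * Suc c then nth_default 0 (tape_tail adj) j else 0)"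
    unfolding inv by (auto simp: fun_eq_iff nth_default_def)
  moreover have "run (copy_body c) s = run [decrement] (run (concat (replicate (Suc c) copy_input)) (v, h, xs))"
    by (simp only: copy_body_def fold_append o_apply s)
  ultimately show ?thesis
    unfolding t using inv by (simp add: copy_inv_def decrement_def ac_simps)
qed

definition index_inv :: "nat \<Rightarrow> nat \<Rightarrow> state \<Rightarrow> bool" where
  "index_inv k i s \<longleftrightarrow> (case s of (v, h, xs) \<Rightarrow>
    v num_deleted = 0 \<and> v num_verts = length adj \<and> v budget = k \<and> v counter = length adj - i \<and>
    v position = offset i \<and> v start_base = starts \<and> v mark_base = marks \<and> v current = i \<and>
    (\<forall>j. h j = (if j < starts then nth_default 0 (tape_tail adj) j
      else if j < starts + i then offset (j - starts) else 0)))"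

lemma index_inv_step:
  assumes "i < length adj" "index_inv k i s"
  shows "index_inv k (Suc i) (run index_body s)"
  using assms offset_Suc[of i] offset_less[of i] tape_tail_nth[of i 0]
  by (cases s) (auto simp: index_inv_def index_body_def decrement_def less_Suc_eq)

text \<open>The cells beyond the table of starts are still zero, which reads as an empty set of
  marks.\<close>

lemma layout_index_inv:
  assumes "index_inv k (length adj) (v, h, xs)"
  shows "layout h {}"
proof -
  have h: "h j = (if j < starts then nth_default 0 (tape_tail adj) j
      else if j < marks then offset (j - starts) else 0)" for j
    using assms by (simp add: index_inv_def marks_def)
  have "h (offset u + i) = (length (adj ! u) # adj ! u) ! i"
    if "u < length adj" "i \<le> length (adj ! u)" for u i
    using that tape_tail_nth[OF that] offset_less[of u] by (simp add: h)
  from this[of _ 0] this[of _ "Suc _"] show ?thesis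
    unfolding layout_def by (auto simp: h marks_def)
qed

lemma extendable_empty: "extendable {}"
  by (auto simp: extendable_def)

section \<open>The complete run and the final result\<close>

lemma runs_program:
  "\<exists>v h xs. runs (program c) (\<lambda>_. 0, \<lambda>_. 0, encode adj k) (running_time c (length adj)) (v, h, xs) \<and>
    v 0 = of_bool (\<exists>S. hitting_set S \<and> card S \<le> k)"
proof -
  let ?n = "length adj"
  define s1 where "s1 = run init_copy (\<lambda>_. 0, \<lambda>_. 0, encode adj k)"
  define s2 where "s2 = (run (copy_body c) ^^ ?n) s1"
  define s3 where "s3 = run init_index s2"
  define s4 where "s4 = (run index_body ^^ ?n) s3"
  define s5 where "s5 = run init_greedy s4"
  define s6 where "s6 = (run (greedy_body c) ^^ ?n) s5"
  define s7 where "s7 = run finish s6"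
  have "copy_inv k 0 s1"
    by (simp add: s1_def init_copy_def copy_inv_def encode_def tape_tail_def)
  then have copy: "copy_inv k i ((run (copy_body c) ^^ i) s1)" if "i \<le> ?n" for i
    using loop_invariant[of "copy_inv k" s1 ?n "copy_body c" i] copy_inv_step that by blast
  then have "copy_inv k ?n s2" by (simp add: s2_def)
  then have "index_inv k 0 s3"
    by (cases s2) (auto simp: s3_def init_index_def copy_inv_def index_inv_def offset_0 starts_def marks_def)
  then have index: "index_inv k i ((run index_body ^^ i) s3)" if "i \<le> ?n" for i
    using loop_invariant[of "index_inv k" s3 ?n index_body i] index_inv_step that by blast
  then have s4: "index_inv k ?n s4" by (simp add: s4_def)
  obtain v4 h4 xs4 where s4': "s4 = (v4, h4, xs4)" by (cases s4)
  have "greedy_inv k 0 ?n {} s5"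
    using s4 layout_index_inv[of k v4 h4 xs4] extendable_empty
    unfolding s5_def s4' by (simp add: init_greedy_def greedy_inv_def index_inv_def)
  then have "greedy_phase_inv k 0 s5" by (auto simp: greedy_phase_inv_def)
  then have greedy: "greedy_phase_inv k i ((run (greedy_body c) ^^ i) s5)" if "i \<le> ?n" for i
    using loop_invariant[of "greedy_phase_inv k" s5 ?n "greedy_body c" i] greedy_phase_inv_step that by blast
  then have "greedy_phase_inv k ?n s6" by (simp add: s6_def)
  \<comment> \<open>Twins are vertices, hence below \<open>length adj\<close>, so the invariant
    after the last round covers all pairs.\<close>
  then obtain D where D: "greedy_inv k ?n 0 D s6" "\<And>x y. twins x y \<Longrightarrow> hits D x y"
    by (auto simp: greedy_phase_inv_def twins_def)
  obtain v h xs where s7: "s7 = (v, h, xs)" by (cases s7)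
  have "extendable D" using D(1) by (auto simp: greedy_inv_def)
  from extendable_optimal[OF this D(2)]
  have "v 0 = of_bool (\<exists>S. hitting_set S \<and> card S \<le> k)"
    using D(1) s7 by (cases s6) (auto simp: greedy_inv_def finish_def s7_def)
  moreover have "runs (program c) (\<lambda>_. 0, \<lambda>_. 0, encode adj k) (running_time c ?n) s7"
    unfolding program_def running_time_def
  \<comment> \<open>What remains of the loop rules are the countdown conditions, which the three
    invariants supply.\<close>
  proof (intro runs_Block runs_Loop adj_nonempty, fold s1_def, fold s2_def, fold s3_def, fold s4_def,
      fold s5_def, fold s6_def, fold s7_def)
    fix i assume i: "i < ?n"
    show "fst ((run (copy_body c) ^^ Suc i) s1) counter = ?n - Suc i"
      using copy[of "Suc i"] i by (auto simp: copy_inv_def simp del: funpow.simps split: prod.splits)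
    show "fst ((run index_body ^^ Suc i) s3) counter = ?n - Suc i"
      using index[of "Suc i"] i by (auto simp: index_inv_def simp del: funpow.simps split: prod.splits)
    show "fst ((run (greedy_body c) ^^ Suc i) s5) counter = ?n - Suc i"
      using greedy[of "Suc i"] i
      by (cases "(run (greedy_body c) ^^ Suc i) s5")
        (auto simp: greedy_phase_inv_def greedy_inv_def simp del: funpow.simps)
  qed (rule runs_Nil)
  ultimately show ?thesis
    using s7 by blast
qed

end

lemma program_solves:
  assumes "0 < c" "c \<le> 3"
  shows "solves_c_closed_vertex_deletion (compile 0 (program c)) c {G. max_degree (with_proj G) = c}
    (running_time c)"
  unfolding solves_c_closed_vertex_deletion_def
proof (intro ballI allI impI)
  fix G adj and k :: nat
  assume G: "G \<in> {G. max_degree (with_proj G) = c}" and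
    adj: "pair_graph G \<and> adjacency_lists G adj \<and> 0 < k"
  have bounded: "bounded_degree_graph {..<length adj} (\<lambda>v. set (adj ! v)) c"
    using bounded_degree_graph_adjacency_lists G adj assms by auto
  have verts: "pverts G = {..<length adj}"
    using adj by (simp add: adjacency_lists_def)
  \<comment> \<open>A \<open>Loop\<close> always executes its body once, so the empty graph must be
    excluded; its maximum degree is 0, less than \<open>c\<close>.\<close>
  have "0 < length adj"
  proof (rule ccontr)
    assume "\<not> 0 < length adj"
    then have "max_degree (with_proj G) = 0" using verts by (simp add: max_degree_def)
    then show False using G assms by simp
  qed
  then interpret adjacency_list_graph adj c
    using bounded adj by (simp add: adjacency_list_graph_def adjacency_list_graph_axioms_def adjacency_lists_def)
  obtain v h xs where runs: "runs (program c) (\<lambda>_. 0, \<lambda>_. 0, encode adj k) (running_time c (length adj)) (v, h, xs)"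
    and answer: "v 0 = of_bool (\<exists>S. hitting_set S \<and> card S \<le> k)"
    using runs_program by blast
  have "answers_within (compile 0 (program c)) (encode adj k) (running_time c (length adj))
      (c_closed_vertex_deletion c (with_proj G) k)"
    using c_closed_vertex_deletion_iff_hitting_set[of G adj c k] bounded adj answer
    by (intro answers_within_compile[OF runs fits_program]) simp
  then show "answers_within (compile 0 (program c)) (encode adj k) (running_time c (card (pverts G)))
      (c_closed_vertex_deletion c (with_proj G) k)"
    by (simp add: verts)
qed

lemma linear_time_c_closed_vertex_deletion:
  assumes "0 < c" "c \<le> 3"
  shows "\<exists>P T. (\<lambda>n. real (T n)) \<in> O(\<lambda>n. real n) \<and>
    solves_c_closed_vertex_deletion P c {G. max_degree (with_proj G) = c} T"
  using running_time_bigo program_solves[OF assms] by blast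

theorem theorem3:
  shows "(\<exists>P T. (\<lambda>n. real (T n)) \<in> O(\<lambda>n. real n) \<and>
            solves_c_closed_vertex_deletion P 2 {G. max_degree (with_proj G) = 2} T) \<and>
         (\<exists>P T. (\<lambda>n. real (T n)) \<in> O(\<lambda>n. real n) \<and>
            solves_c_closed_vertex_deletion P 3 {G. max_degree (with_proj G) = 3} T)"
  by (intro conjI linear_time_c_closed_vertex_deletion) simp_all

end
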